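(* Every connected $I$-space is a $D$-space.
   Context: A topological space $(X,\tau)$ is an $I$-space if its derived set $X^d$ (the set of all non-isolated points of $X$) is closed and discrete, i.e. closed and every point of $X^d$ is isolated in $X^d$. A neighborhood assignment on $(X,\tau)$ is a function $\phi:X\to\tau$ with $x\in\phi(x)$ for all $x$. $(X,\tau)$ is a $D$-space if for every neighborhood assignment $\phi$ on $X$ there is a closed discrete subset $D\subseteq X$ such that $\bigcup_{x\in D}\phi(x)=X$. No separation axioms are assumed. *)

theory Defs
  imports "HOL-Analysis.Analysis"
begin

text \<open>
  The equation forces \<open>S \<subseteq> topspace X\<close>, because \<open>topspace (subtopology X S) = topspace X \<inter> S\<close>.
\<close>

definition closed_discrete_in :: "'a topology \<Rightarrow> 'a set \<Rightarrow> bool" where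
  "closed_discrete_in X S \<longleftrightarrow> closedin X S \<and> subtopology X S = discrete_topology S"

definition I_space :: "'a topology \<Rightarrow> bool" where
  "I_space X \<longleftrightarrow> closed_discrete_in X (X derived_set_of (topspace X))"

definition neighborhood_assignment :: "'a topology \<Rightarrow> ('a \<Rightarrow> 'a set) \<Rightarrow> bool" where
  "neighborhood_assignment X \<phi> \<longleftrightarrow> (\<forall>x\<in>topspace X. openin X (\<phi> x) \<and> x \<in> \<phi> x)"

definition D_space :: "'a topology \<Rightarrow> bool" where
  "D_space X \<longleftrightarrow>
     (\<forall>\<phi>. neighborhood_assignment X \<phi> \<longrightarrow>
        (\<exists>D. closed_discrete_in X D \<and> (\<Union>x\<in>D. \<phi> x) = topspace X))"

end

theory Submission
  imports Defs
begin

text \<open>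
  Let \<open>N\<close> be the derived set of the space, and let \<open>R\<close> be the set of
  points not covered by the neighbourhoods assigned to points of \<open>N\<close>. Both are closed and \<open>R\<close> is
  disjoint from \<open>N\<close>, so neither has a limit point; hence \<open>N \<union> R\<close> is closed and discrete.
\<close>

text \<open>Closedness puts all limit points of \<open>S\<close> inside \<open>S\<close>,
  discreteness keeps them outside. This form passes to finite unions, since derived sets distribute
  over them.\<close>

lemma closed_discrete_in_iff_derived_set_empty:
  "closed_discrete_in X S \<longleftrightarrow> S \<subseteq> topspace X \<and> X derived_set_of S = {}"
  unfolding closed_discrete_in_def closedin_contains_derived_set
    subtopology_eq_discrete_topology_eq
  by blast

lemma I_space_imp_D_space:
  assumes "I_space X"
  shows "D_space X"
  unfolding D_space_def
proof (intro allI impI)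
  fix \<phi> assume "neighborhood_assignment X \<phi>"
  then have open_\<phi>: "openin X (\<phi> x)" and mem_\<phi>: "x \<in> \<phi> x" if "x \<in> topspace X" for x
    using that by (auto simp: neighborhood_assignment_def)
  define N where "N = X derived_set_of topspace X"
  define R where "R = topspace X - (\<Union>x\<in>N. \<phi> x)"
  have N: "N \<subseteq> topspace X" "X derived_set_of N = {}"
    using assms by (simp_all add: I_space_def closed_discrete_in_iff_derived_set_empty N_def)
  have R: "R \<subseteq> topspace X" "N \<inter> R = {}"
    using N(1) mem_\<phi> by (auto simp: R_def)
  have "closedin X R"
    unfolding R_def using N(1) open_\<phi> by (intro closedin_diff) auto
  then have "X derived_set_of R \<subseteq> R"
    by (simp add: closedin_contains_derived_set)
  \<comment> \<open>A limit point of \<open>R\<close> is a limit point of the whole space, hence in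
    \<open>N\<close>, which misses \<open>R\<close>.\<close>
  moreover have "X derived_set_of R \<subseteq> N"
    unfolding N_def by (rule derived_set_of_mono[OF R(1)])
  ultimately have "X derived_set_of R = {}"
    using R(2) by blast
  with N R(1) have "closed_discrete_in X (N \<union> R)"
    by (simp add: closed_discrete_in_iff_derived_set_empty derived_set_of_Un)
  moreover have "(\<Union>x\<in>N \<union> R. \<phi> x) = topspace X"
  proof
    show "(\<Union>x\<in>N \<union> R. \<phi> x) \<subseteq> topspace X"
      using N(1) R(1) open_\<phi> openin_subset by blast
    \<comment> \<open>A point missed by the sets assigned to \<open>N\<close> lies in
      \<open>R\<close> and is covered by its own neighbourhood.\<close>
    show "topspace X \<subseteq> (\<Union>x\<in>N \<union> R. \<phi> x)"
      using mem_\<phi> by (auto simp: R_def)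
  qed
  ultimately show "\<exists>D. closed_discrete_in X D \<and> (\<Union>x\<in>D. \<phi> x) = topspace X"
    by blast
qed

theorem theorem3p37:
  fixes X :: "'a topology"
  assumes "connected_space X" and "I_space X"
  shows "D_space X"
  using assms(2) by (rule I_space_imp_D_space)

end
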